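(* Let $M=M(\lambda)\in\mathbb{W}^{n\times n}$, let $\{1,\dots,n\}=S\cup\overline S$ be a partition with $S\neq\varnothing$, and let $\lambda_0\in\sigma(M(\lambda))$ be such that the matrix $M_{\overline S\,\overline S}(\lambda_0)-\lambda_0I$ is invertible. If $u\in\mathbb{C}^n$ is an eigenvector of $M$ for $\lambda_0$, i.e. $u\neq0$ and $M(\lambda_0)u=\lambda_0u$, then its restriction $u_S$ is an eigenvector of the isospectral reduction $R_S$ for the same eigenvalue: $u_S\ne 0$ and $R_S(\lambda_0)u_S=\lambda_0u_S$.
   Context: $\mathbb{W}$ is the field of rational functions in $\lambda$ over $\mathbb{C}$. For $M(\lambda)\in\mathbb{W}^{n\times n}$, $\sigma(M(\lambda))$ is the multiset of complex zeros of $\det(M(\lambda)-\lambda I)$. Writing $M(\lambda_0)$ presupposes that the entries have no pole at $\lambda_0$. For index sets $A,B$, $M_{AB}$ is the submatrix with rows in $A$ and columns in $B$, and $u_S=(u_i)_{i\in S}$. The isospectral (matrix) reduction of $M$ onto $S$ is $$R_S(\lambda)=M_{SS}-M_{S\overline S}(M_{\overline S\,\overline S}-\lambda I)^{-1}M_{\overline SS}.$$ *)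

theory Defs
  imports
    "Jordan_Normal_Form.Char_Poly"
    "Jordan_Normal_Form.Gauss_Jordan_Elimination"
    "Jordan_Normal_Form.DL_Submatrix"
    "HOL-Computational_Algebra.Computational_Algebra"
    "HOL-Computational_Algebra.Field_as_Ring"
    "HOL-Library.Extended_Nat"
begin

(* Entries are formal rational functions; quot_of_fract gives the reduced representation
   (coprime numerator and denominator), so a removable singularity is not a pole. *)
type_synonym ratfun = "complex poly fract"

definition num_of :: "ratfun \<Rightarrow> complex poly" where
  "num_of f = fst (quot_of_fract f)"

definition denom_of :: "ratfun \<Rightarrow> complex poly" where
  "denom_of f = snd (quot_of_fract f)"

definition no_pole :: "ratfun \<Rightarrow> complex \<Rightarrow> bool" where
  "no_pole f z \<longleftrightarrow> poly (denom_of f) z \<noteq> 0"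

(* Only meaningful when no_pole f z. *)
definition eval_rf :: "ratfun \<Rightarrow> complex \<Rightarrow> complex" where
  "eval_rf f z = poly (num_of f) z / poly (denom_of f) z"

definition lam :: ratfun where
  "lam = to_fract [:0, 1:]"

definition no_pole_mat :: "ratfun mat \<Rightarrow> complex \<Rightarrow> bool" where
  "no_pole_mat M z \<longleftrightarrow> (\<forall>i < dim_row M. \<forall>j < dim_col M. no_pole (M $$ (i, j)) z)"

definition eval_mat :: "ratfun mat \<Rightarrow> complex \<Rightarrow> complex mat" where
  "eval_mat M z = map_mat (\<lambda>f. eval_rf f z) M"

(* Multiplicity of z as a zero. The zero function vanishes everywhere to infinite order,
   which is why multiplicities, and hence the multiset sigma, take values in enat. *)
definition zero_mult :: "ratfun \<Rightarrow> complex \<Rightarrow> enat" where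
  "zero_mult f z = (if f = 0 then \<infinity> else enat (Polynomial.order z (num_of f)))"

(* The multiset of zeros of det (M - lambda I), given by its multiplicity function. *)
definition sigma :: "ratfun mat \<Rightarrow> complex \<Rightarrow> enat" where
  "sigma M = zero_mult (det (M - lam \<cdot>\<^sub>m 1\<^sub>m (dim_row M)))"

definition in_sigma :: "complex \<Rightarrow> ratfun mat \<Rightarrow> bool" where
  "in_sigma z M \<longleftrightarrow> sigma M z > 0"

(* Indices are 0-based; the entries u_i with i in S are listed in increasing order of i,
   as in submatrix. *)
definition subvec :: "'a vec \<Rightarrow> nat set \<Rightarrow> 'a vec" where
  "subvec u S = vec (card {i. i < dim_vec u \<and> i \<in> S}) (\<lambda>i. u $ pick S i)"

(* The inverse is taken over the field of rational functions; mat_inverse returns None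
   exactly for matrices singular over that field. *)
definition isospectral_reduction :: "ratfun mat \<Rightarrow> nat set \<Rightarrow> ratfun mat" where
  "isospectral_reduction M S =
     (let T = {..<dim_row M} - S
      in submatrix M S S
           - submatrix M S T
             * the (mat_inverse (submatrix M T T - lam \<cdot>\<^sub>m 1\<^sub>m (card T)))
             * submatrix M T S)"

lemma num_denom: "f = Fract (num_of f) (denom_of f)" "denom_of f \<noteq> 0"
  "coprime (num_of f) (denom_of f)"
proof -
  show "denom_of f \<noteq> 0" by (simp add: denom_of_def)
  show "coprime (num_of f) (denom_of f)"
    using coprime_quot_of_fract by (simp add: num_of_def denom_of_def)
  show "f = Fract (num_of f) (denom_of f)"
    by (metis denom_of_def num_of_def Fract_quot_of_fract)
qed

lemma eval_rf_Fract:
  assumes "poly q z \<noteq> 0"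
  shows "no_pole (Fract p q) z" "eval_rf (Fract p q) z = poly p z / poly q z"
proof -
  define a b where "a = num_of (Fract p q)" and "b = denom_of (Fract p q)"
  have q: "q \<noteq> 0" using assms by auto
  have eq: "Fract p q = Fract a b" and b: "b \<noteq> 0" and cop: "coprime a b"
    using num_denom[of "Fract p q"] by (auto simp: a_def b_def)
  have cross: "p * b = a * q" using eq q b by (simp add: eq_fract)
  have "b dvd a * q" using cross by (metis dvd_triv_right)
  hence "b dvd q" using cop by (metis coprime_commute coprime_dvd_mult_right_iff)
  hence bz: "poly b z \<noteq> 0" using assms by auto
  thus "no_pole (Fract p q) z" by (simp add: no_pole_def b_def)
  have "poly p z * poly b z = poly a z * poly q z"
    using arg_cong[OF cross, of "\<lambda>r. poly r z"] by simp
  thus "eval_rf (Fract p q) z = poly p z / poly q z"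
    using assms bz by (simp add: eval_rf_def a_def[symmetric] b_def[symmetric] frac_eq_eq)
qed

lemma sigma_eq_count:
  assumes "det (M - lam \<cdot>\<^sub>m 1\<^sub>m (dim_row M)) \<noteq> 0"
  shows "sigma M z = enat (count (proots (num_of (det (M - lam \<cdot>\<^sub>m 1\<^sub>m (dim_row M))))) z)"
proof -
  have "num_of (det (M - lam \<cdot>\<^sub>m 1\<^sub>m (dim_row M))) \<noteq> 0"
    using assms num_denom by (metis Zero_fract_def eq_fract(2) fract_collapse(1))
  thus ?thesis using assms by (simp add: sigma_def zero_mult_def)
qed

end

theory Submission
  imports Defs
begin

text \<open>
  Evaluation at a point \<open>z\<close> is a ring homomorphism on the rational functions that are regular at
  \<open>z\<close>, and it also respects quotients whose denominator does not vanish at \<open>z\<close>. The regular functions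
  therefore admit every operation in the isospectral reduction, with the inverse as the only delicate
  point: an inverse over the field of rational functions need not be regular, nor need it exist just
  because entries are regular. Both questions are settled by the determinant. It commutes with
  evaluation, so if the evaluated matrix is invertible, then the determinant is a rational function
  with nonzero value at \<open>z\<close>; the inverse is the adjugate divided by this determinant, hence regular, and
  its value is the inverse of the evaluated matrix (\<open>has_value_mat_inverse\<close>).

  This reduces the theorem to a statement about complex matrices (\<open>schur_eigenvector\<close>). Splitting
  \<open>M u = k u\<close> into blocks gives \<open>M\<^sub>S\<^sub>S u\<^sub>S + M\<^sub>S\<^sub>T u\<^sub>T = k u\<^sub>S\<close> and \<open>(M\<^sub>T\<^sub>T - k I) u\<^sub>T = - M\<^sub>T\<^sub>S u\<^sub>S\<close>, where
  \<open>T\<close> is the complement of \<open>S\<close>. The second equation determines \<open>u\<^sub>T\<close> from \<open>u\<^sub>S\<close>. Substituting it into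
  the first gives the reduced eigenvector equation, and \<open>u\<^sub>S = 0\<close> would force \<open>u\<^sub>T = 0\<close> and so \<open>u = 0\<close>.
\<close>

section \<open>Values of rational functions\<close>

text \<open>
  Regularity and value are carried through all computations together, because \<open>eval_rf\<close> is
  compatible with the field operations only away from poles.
\<close>

definition has_value :: "ratfun \<Rightarrow> complex \<Rightarrow> complex \<Rightarrow> bool" where
  "has_value f z c \<longleftrightarrow> no_pole f z \<and> eval_rf f z = c"

text \<open>
  Any representing fraction may be used in place of the reduced one, as long as its denominator
  does not vanish; the closure properties below then reduce to fraction arithmetic.
\<close>

lemma has_value_iff_Fract:
  "has_value f z c \<longleftrightarrow> (\<exists>p q. f = Fract p q \<and> poly q z \<noteq> 0 \<and> c = poly p z / poly q z)"
proof
  assume "has_value f z c"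
  then show "\<exists>p q. f = Fract p q \<and> poly q z \<noteq> 0 \<and> c = poly p z / poly q z"
    using num_denom(1)[of f] by (auto simp: has_value_def no_pole_def eval_rf_def)
next
  assume "\<exists>p q. f = Fract p q \<and> poly q z \<noteq> 0 \<and> c = poly p z / poly q z"
  then show "has_value f z c"
    using eval_rf_Fract by (auto simp: has_value_def)
qed

lemma has_value_FractI:
  "poly q z \<noteq> 0 \<Longrightarrow> c = poly p z / poly q z \<Longrightarrow> has_value (Fract p q) z c"
  using has_value_iff_Fract by blast

lemma has_value_FractE:
  assumes "has_value f z c"
  obtains p q where "f = Fract p q" "q \<noteq> 0" "poly q z \<noteq> 0" "c = poly p z / poly q z"
  using assms unfolding has_value_iff_Fract by force

lemma has_value_add:
  assumes "has_value f z a" "has_value g z b"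
  shows "has_value (f + g) z (a + b)"
proof -
  obtain p q where f: "f = Fract p q" "q \<noteq> 0" "poly q z \<noteq> 0" "a = poly p z / poly q z"
    using assms(1) by (rule has_value_FractE)
  obtain r s where g: "g = Fract r s" "s \<noteq> 0" "poly s z \<noteq> 0" "b = poly r z / poly s z"
    using assms(2) by (rule has_value_FractE)
  show ?thesis
    unfolding f(1) g(1) add_fract[OF f(2) g(2)]
    by (rule has_value_FractI) (use f g in \<open>simp_all add: add_frac_eq\<close>)
qed

lemma has_value_mult:
  assumes "has_value f z a" "has_value g z b"
  shows "has_value (f * g) z (a * b)"
proof -
  obtain p q where f: "f = Fract p q" "q \<noteq> 0" "poly q z \<noteq> 0" "a = poly p z / poly q z"
    using assms(1) by (rule has_value_FractE)
  obtain r s where g: "g = Fract r s" "s \<noteq> 0" "poly s z \<noteq> 0" "b = poly r z / poly s z"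
    using assms(2) by (rule has_value_FractE)
  show ?thesis
    unfolding f(1) g(1) mult_fract
    by (rule has_value_FractI) (use f g in simp_all)
qed

lemma has_value_inverse:
  assumes "has_value f z a" "a \<noteq> 0"
  shows "has_value (inverse f) z (inverse a)"
proof -
  obtain p q where f: "f = Fract p q" "poly q z \<noteq> 0" "a = poly p z / poly q z"
    using assms(1) by (rule has_value_FractE)
  show ?thesis
    unfolding f(1) inverse_fract
    by (rule has_value_FractI) (use f assms(2) in simp_all)
qed

lemma has_value_0: "has_value 0 z 0"
  unfolding Zero_fract_def by (rule has_value_FractI) simp_all

lemma has_value_1: "has_value 1 z 1"
  unfolding One_fract_def by (rule has_value_FractI) simp_all

lemma has_value_lam: "has_value lam z z"
  unfolding lam_def to_fract_def by (rule has_value_FractI) simp_all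

lemma has_value_uminus:
  assumes "has_value f z a"
  shows "has_value (- f) z (- a)"
proof -
  obtain p q where f: "f = Fract p q" "poly q z \<noteq> 0" "a = poly p z / poly q z"
    using assms by (rule has_value_FractE)
  show ?thesis
    unfolding f(1) minus_fract
    by (rule has_value_FractI) (use f in simp_all)
qed

lemma has_value_diff:
  "has_value f z a \<Longrightarrow> has_value g z b \<Longrightarrow> has_value (f - g) z (a - b)"
  using has_value_add[of f z a "- g" "- b"] has_value_uminus by simp

lemma has_value_sum:
  "(\<And>i. i \<in> I \<Longrightarrow> has_value (f i) z (a i)) \<Longrightarrow> has_value (sum f I) z (sum a I)"
  by (induction I rule: infinite_finite_induct) (simp_all add: has_value_0 has_value_add)

lemma has_value_prod:
  "(\<And>i. i \<in> I \<Longrightarrow> has_value (f i) z (a i)) \<Longrightarrow> has_value (prod f I) z (prod a I)"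
  by (induction I rule: infinite_finite_induct) (simp_all add: has_value_1 has_value_mult)

lemma has_value_power: "has_value f z a \<Longrightarrow> has_value (f ^ k) z (a ^ k)"
  by (induction k) (simp_all add: has_value_1 has_value_mult)

lemma has_value_signof: "has_value (signof p) z (signof p)"
  by (simp add: sign_def has_value_1 has_value_uminus)

section \<open>Values of matrices of rational functions\<close>

definition mat_has_value :: "ratfun mat \<Rightarrow> complex \<Rightarrow> complex mat \<Rightarrow> bool" where
  "mat_has_value A z B \<longleftrightarrow> dim_row B = dim_row A \<and> dim_col B = dim_col A \<and>
     (\<forall>i < dim_row A. \<forall>j < dim_col A. has_value (A $$ (i, j)) z (B $$ (i, j)))"

lemma mat_has_value_iff: "mat_has_value A z B \<longleftrightarrow> no_pole_mat A z \<and> eval_mat A z = B"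
proof
  assume "mat_has_value A z B"
  then show "no_pole_mat A z \<and> eval_mat A z = B"
    by (auto simp: mat_has_value_def has_value_def no_pole_mat_def eval_mat_def intro!: eq_matI)
next
  assume "no_pole_mat A z \<and> eval_mat A z = B"
  then show "mat_has_value A z B"
    by (auto simp: mat_has_value_def has_value_def no_pole_mat_def eval_mat_def)
qed

lemma mat_has_value_carrier:
  "mat_has_value A z B \<Longrightarrow> A \<in> carrier_mat m n \<Longrightarrow> B \<in> carrier_mat m n"
  by (auto simp: mat_has_value_def)

lemma mat_has_value_diff:
  assumes "mat_has_value A z A'" "mat_has_value B z B'"
    and "A \<in> carrier_mat m n" "B \<in> carrier_mat m n"
  shows "mat_has_value (A - B) z (A' - B')"
  using assms by (auto simp: mat_has_value_def has_value_diff)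

lemma mat_has_value_mult:
  assumes "mat_has_value A z A'" "mat_has_value B z B'"
    and "A \<in> carrier_mat m n" "B \<in> carrier_mat n l"
  shows "mat_has_value (A * B) z (A' * B')"
  using assms
  by (auto simp: mat_has_value_def scalar_prod_def intro!: has_value_sum has_value_mult)

lemma mat_has_value_lam_one: "mat_has_value (lam \<cdot>\<^sub>m 1\<^sub>m n) z (z \<cdot>\<^sub>m 1\<^sub>m n)"
  by (auto simp: mat_has_value_def has_value_lam has_value_0)

lemma mat_has_value_submatrix:
  assumes "mat_has_value A z B"
  shows "mat_has_value (submatrix A I J) z (submatrix B I J)"
  using assms pick_le[of _ "dim_row A" I] pick_le[of _ "dim_col A" J]
  by (auto simp: mat_has_value_def submatrix_def)

lemma mat_has_value_mat_delete:
  assumes "mat_has_value A z B"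
  shows "mat_has_value (mat_delete A i j) z (mat_delete B i j)"
  using assms by (auto simp: mat_has_value_def mat_delete_def)

lemma has_value_det:
  assumes "mat_has_value A z B"
  shows "has_value (det A) z (det B)"
proof (cases "dim_row A = dim_col A")
  case True
  then have "has_value (A $$ (i, p i)) z (B $$ (i, p i))"
    if "p permutes {0..<dim_row A}" "i \<in> {0..<dim_row A}" for p i
    using assms that permutes_in_image[OF that(1), of i] by (auto simp: mat_has_value_def)
  then show ?thesis
    using assms True
    by (auto simp: det_def mat_has_value_def
        intro!: has_value_sum has_value_mult has_value_prod has_value_signof)
next
  case False
  then show ?thesis
    using assms by (simp add: det_def mat_has_value_def has_value_0)
qed

lemma mat_has_value_adj_mat:
  assumes "mat_has_value A z B"
  shows "mat_has_value (adj_mat A) z (adj_mat B)"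
proof -
  have "has_value (cofactor A i j) z (cofactor B i j)" for i j
    unfolding cofactor_def
    by (intro has_value_mult has_value_power has_value_uminus has_value_1 has_value_det
        mat_has_value_mat_delete assms)
  then show ?thesis
    using assms unfolding mat_has_value_def by (simp add: adj_mat_def)
qed

lemma det_nonzero_of_invertible:
  fixes A :: "'a :: field mat"
  assumes "invertible_mat A" "A \<in> carrier_mat n n"
  shows "det A \<noteq> 0"
proof -
  obtain B where B: "A * B = 1\<^sub>m n" "B * A = 1\<^sub>m (dim_row B)"
    using assms unfolding invertible_mat_def inverts_mat_def by auto
  have "dim_col B = n" "dim_row B = n"
    using arg_cong[OF B(1), of dim_col] arg_cong[OF B(2), of dim_col] assms(2) by auto
  then have "det A * det B = 1"
    using det_mult[OF assms(2), of B] B(1) by auto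
  then show ?thesis by auto
qed

text \<open>
  By Cramer's rule the inverse has only the zeros of the determinant as additional poles, and the
  determinant does not vanish at \<open>z\<close> because it commutes with evaluation. That the value of the
  inverse inverts \<open>A'\<close> follows by evaluating the identity \<open>B A = I\<close>.
\<close>

lemma has_value_mat_inverse:
  assumes val: "mat_has_value A z A'" and A: "A \<in> carrier_mat n n" and inv: "invertible_mat A'"
  obtains B B' where "mat_inverse A = Some B" "B \<in> carrier_mat n n" "B' \<in> carrier_mat n n"
    "mat_has_value B z B'" "B' * A' = 1\<^sub>m n"
proof -
  have A': "A' \<in> carrier_mat n n"
    using mat_has_value_carrier[OF val A] .
  have det': "det A' \<noteq> 0"
    using det_nonzero_of_invertible[OF inv A'] .
  have hdet: "has_value (det A) z (det A')"
    using has_value_det[OF val] .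
  have det: "det A \<noteq> 0"
    using hdet has_value_0[of z] det' by (auto simp: has_value_def)
  have "A \<in> Units (ring_mat TYPE(ratfun) n ())"
    using det_non_zero_imp_unit[OF A det] .
  then obtain B where inverse: "mat_inverse A = Some B"
    using mat_inverse(1)[OF A, where b = "()"] by (cases "mat_inverse A") auto
  have B: "A * B = 1\<^sub>m n" "B * A = 1\<^sub>m n" "B \<in> carrier_mat n n"
    using mat_inverse(2)[OF A inverse] by auto
  have "adj_mat A = (B * A) * adj_mat A"
    using B(2) adj_mat(1)[OF A] by simp
  also have "\<dots> = B * (det A \<cdot>\<^sub>m 1\<^sub>m n)"
    using assoc_mult_mat[OF B(3) A adj_mat(1)[OF A]] adj_mat(2)[OF A] by simp
  also have "\<dots> = det A \<cdot>\<^sub>m B"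
    using mult_smult_distrib[OF B(3) one_carrier_mat] B(3) by simp
  finally have adj: "adj_mat A = det A \<cdot>\<^sub>m B" .
  have entry: "B $$ (i, j) = inverse (det A) * adj_mat A $$ (i, j)" if "i < n" "j < n" for i j
    using that B(3) det by (simp add: adj field_simps)
  have "has_value (B $$ (i, j)) z (inverse (det A') * adj_mat A' $$ (i, j))"
    if "i < n" "j < n" for i j
    using mat_has_value_adj_mat[OF val] adj_mat(1)[OF A] that
    unfolding entry[OF that]
    by (intro has_value_mult has_value_inverse hdet det') (auto simp: mat_has_value_def)
  then have valB: "mat_has_value B z (eval_mat B z)"
    using B(3) unfolding mat_has_value_iff no_pole_mat_def has_value_def by auto
  have "mat_has_value (B * A) z (eval_mat B z * A')"
    using mat_has_value_mult[OF valB val B(3) A] .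
  moreover have "mat_has_value (1\<^sub>m n) z (1\<^sub>m n)"
    by (auto simp: mat_has_value_def has_value_0 has_value_1)
  ultimately have "eval_mat B z * A' = 1\<^sub>m n"
    by (simp add: B(2) mat_has_value_iff)
  then show thesis
    using that inverse B(3) mat_has_value_carrier[OF valB B(3)] valB by blast
qed

section \<open>Block decomposition along an index set\<close>

lemma bij_betw_pick:
  assumes "finite I"
  shows "bij_betw (pick I) {0..<card I} I"
proof -
  have inj: "inj_on (pick I) {0..<card I}"
    by (rule linorder_inj_onI) (auto dest: pick_mono_le[of _ I])
  moreover have "pick I ` {0..<card I} \<subseteq> I"
    using pick_in_set_le by auto
  ultimately have "pick I ` {0..<card I} = I"
    using card_subset_eq[OF assms] card_image[OF inj] by simp
  with inj show ?thesis by (simp add: bij_betw_def)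
qed

lemma Collect_less_mem: "I \<subseteq> {..<n} \<Longrightarrow> {i. i < n \<and> i \<in> I} = (I :: nat set)"
  by auto

lemma submatrix_carrier:
  assumes "M \<in> carrier_mat m n" "I \<subseteq> {..<m}" "J \<subseteq> {..<n}"
  shows "submatrix M I J \<in> carrier_mat (card I) (card J)"
  using assms Collect_less_mem by (auto simp: dim_submatrix intro!: carrier_matI)

lemma subvec_carrier:
  assumes "v \<in> carrier_vec n" "I \<subseteq> {..<n}"
  shows "subvec v I \<in> carrier_vec (card I)"
  using assms Collect_less_mem by (auto simp: subvec_def)

lemma subvec_mult_mat_vec:
  fixes M :: "'a :: comm_ring_1 mat"
  assumes M: "M \<in> carrier_mat m n" and u: "u \<in> carrier_vec n"
    and I: "I \<subseteq> {..<m}" and S: "S \<subseteq> {..<n}"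
  defines "T \<equiv> {..<n} - S"
  shows "subvec (M *\<^sub>v u) I = submatrix M I S *\<^sub>v subvec u S + submatrix M I T *\<^sub>v subvec u T"
proof (rule eq_vecI)
  have T: "T \<subseteq> {..<n}" by (auto simp: T_def)
  have fin: "finite S" "finite T"
    using S T finite_subset by auto
  note carr = submatrix_carrier[OF M I S] submatrix_carrier[OF M I T]
  show "dim_vec (subvec (M *\<^sub>v u) I) =
      dim_vec (submatrix M I S *\<^sub>v subvec u S + submatrix M I T *\<^sub>v subvec u T)"
    using carr M Collect_less_mem[OF I] by (simp add: subvec_def)
  fix i assume "i < dim_vec (submatrix M I S *\<^sub>v subvec u S + submatrix M I T *\<^sub>v subvec u T)"
  then have i: "i < card I" using carr by simp
  then have pick_i: "pick I i < m" using I pick_in_set_le by blast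
  have block: "(submatrix M I J *\<^sub>v subvec u J) $ i = (\<Sum>j\<in>J. M $$ (pick I i, j) * u $ j)"
    if J: "J \<subseteq> {..<n}" for J
  proof -
    have "(submatrix M I J *\<^sub>v subvec u J) $ i =
        (\<Sum>k = 0..<card J. M $$ (pick I i, pick J k) * u $ pick J k)"
      using i M u
      by (simp add: scalar_prod_def submatrix_def subvec_def Collect_less_mem[OF I]
          Collect_less_mem[OF J])
    also have "\<dots> = (\<Sum>j\<in>J. M $$ (pick I i, j) * u $ j)"
      by (rule sum.reindex_bij_betw[OF bij_betw_pick]) (use J finite_subset in auto)
    finally show ?thesis .
  qed
  have "subvec (M *\<^sub>v u) I $ i = (\<Sum>j\<in>{..<n}. M $$ (pick I i, j) * u $ j)"
    using i M u pick_i Collect_less_mem[OF I]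
    by (auto simp: subvec_def scalar_prod_def lessThan_atLeast0 intro!: sum.cong)
  also have "{..<n} = S \<union> T" using S by (auto simp: T_def)
  also have "(\<Sum>j\<in>S \<union> T. M $$ (pick I i, j) * u $ j) =
      (\<Sum>j\<in>S. M $$ (pick I i, j) * u $ j) + (\<Sum>j\<in>T. M $$ (pick I i, j) * u $ j)"
    using fin by (intro sum.union_disjoint) (auto simp: T_def)
  finally show "subvec (M *\<^sub>v u) I $ i =
      (submatrix M I S *\<^sub>v subvec u S + submatrix M I T *\<^sub>v subvec u T) $ i"
    using i carr block[OF S] block[OF T] by simp
qed

lemma vec_eq_0_if_subvecs_eq_0:
  assumes u: "u \<in> carrier_vec n" and S: "S \<subseteq> {..<n}"
    and "subvec u S = 0\<^sub>v (card S)"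
    and "subvec u ({..<n} - S) = 0\<^sub>v (card ({..<n} - S))"
  shows "u = 0\<^sub>v n"
proof (rule eq_vecI)
  have "u $ i = 0" if "subvec u I = 0\<^sub>v (card I)" "i \<in> I" and I: "I \<subseteq> {..<n}" for I i
  proof -
    have "i \<in> pick I ` {0..<card I}"
      using bij_betw_pick[OF finite_subset[OF I]] that(2) by (simp add: bij_betw_def)
    then obtain k where k: "k < card I" "i = pick I k" by auto
    have "subvec u I $ k = u $ i"
      using u k Collect_less_mem[OF I] by (simp add: subvec_def)
    with that(1) k(1) show ?thesis by simp
  qed
  then show "u $ i = 0\<^sub>v n $ i" if "i < dim_vec (0\<^sub>v n)" for i
    using that assms by (cases "i \<in> S") auto
qed (use u in simp)

lemma mult_mat_vec_uminus:
  fixes A :: "'a :: comm_ring_1 mat"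
  assumes "A \<in> carrier_mat m n" "v \<in> carrier_vec n"
  shows "A *\<^sub>v (- v) = - (A *\<^sub>v v)"
  using assms by (intro eq_vecI) auto

text \<open>
  The first block row of \<open>M u = k u\<close> is the reduced equation once \<open>u\<^sub>T = - B M\<^sub>T\<^sub>S u\<^sub>S\<close> is known,
  and this formula for \<open>u\<^sub>T\<close> is the second block row multiplied by \<open>B\<close>.
\<close>

lemma schur_eigenvector:
  fixes M :: "'a :: comm_ring_1 mat"
  assumes M: "M \<in> carrier_mat n n" and S: "S \<subseteq> {..<n}"
  defines "T \<equiv> {..<n} - S"
  assumes B: "B \<in> carrier_mat (card T) (card T)"
    and inv: "B * (submatrix M T T - k \<cdot>\<^sub>m 1\<^sub>m (card T)) = 1\<^sub>m (card T)"
    and eig: "eigenvector M u k"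
  shows "eigenvector (submatrix M S S - submatrix M S T * B * submatrix M T S) (subvec u S) k"
proof -
  have T: "T \<subseteq> {..<n}" by (auto simp: T_def)
  have u: "u \<in> carrier_vec n" "u \<noteq> 0\<^sub>v n" "M *\<^sub>v u = k \<cdot>\<^sub>v u"
    using eig M by (auto simp: eigenvector_def)
  define uS uT where "uS = subvec u S" and "uT = subvec u T"
  define SS ST TS TT where "SS = submatrix M S S" and "ST = submatrix M S T"
    and "TS = submatrix M T S" and "TT = submatrix M T T"
  note defs = uS_def uT_def SS_def ST_def TS_def TT_def
  have carr: "uS \<in> carrier_vec (card S)" "uT \<in> carrier_vec (card T)"
    "SS \<in> carrier_mat (card S) (card S)" "ST \<in> carrier_mat (card S) (card T)"
    "TS \<in> carrier_mat (card T) (card S)" "TT \<in> carrier_mat (card T) (card T)"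
    unfolding defs using M S T u(1) by (auto intro!: submatrix_carrier subvec_carrier)
  have split: "subvec (k \<cdot>\<^sub>v u) I = k \<cdot>\<^sub>v subvec u I" if "I \<subseteq> {..<n}" for I
  proof -
    have "pick I i < n" if "i < card I" for i
      using pick_in_set_le[OF that] \<open>I \<subseteq> {..<n}\<close> by auto
    then show ?thesis
      using u(1) Collect_less_mem[OF that] by (auto simp: subvec_def)
  qed
  have rowS: "k \<cdot>\<^sub>v uS = SS *\<^sub>v uS + ST *\<^sub>v uT"
    using subvec_mult_mat_vec[OF M u(1) S S] split[OF S] by (simp add: u(3) defs T_def)
  have rowT: "k \<cdot>\<^sub>v uT = TS *\<^sub>v uS + TT *\<^sub>v uT"
    using subvec_mult_mat_vec[OF M u(1) T S] split[OF T] by (simp add: u(3) defs T_def)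
  have smult_mat_mult_vec: "(k \<cdot>\<^sub>m 1\<^sub>m (card T)) *\<^sub>v uT = k \<cdot>\<^sub>v uT"
    using carr(2) by (intro eq_vecI) auto
  have "(TT - k \<cdot>\<^sub>m 1\<^sub>m (card T)) *\<^sub>v uT = TT *\<^sub>v uT - k \<cdot>\<^sub>v uT"
    using carr minus_mult_distrib_mat_vec[OF carr(6) _ carr(2), of "k \<cdot>\<^sub>m 1\<^sub>m (card T)"]
    by (simp add: smult_mat_mult_vec)
  also have "\<dots> = - (TS *\<^sub>v uS)"
    unfolding rowT using carr by (intro eq_vecI) auto
  finally have elim: "(TT - k \<cdot>\<^sub>m 1\<^sub>m (card T)) *\<^sub>v uT = - (TS *\<^sub>v uS)" .
  have "uT = (B * (TT - k \<cdot>\<^sub>m 1\<^sub>m (card T))) *\<^sub>v uT"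
    using inv carr by (simp add: defs)
  also have "\<dots> = B *\<^sub>v (- (TS *\<^sub>v uS))"
    using assoc_mult_mat_vec[OF B minus_carrier_mat carr(2), of "k \<cdot>\<^sub>m 1\<^sub>m (card T)" TT] elim
    by simp
  finally have uT: "uT = B *\<^sub>v (- (TS *\<^sub>v uS))" .
  have "uS \<noteq> 0\<^sub>v (card S)"
  proof
    assume 0: "uS = 0\<^sub>v (card S)"
    then have "TS *\<^sub>v uS = 0\<^sub>v (card T)"
      using carr by (intro eq_vecI) auto
    then have "uT = 0\<^sub>v (card T)"
      using uT B by (intro eq_vecI) auto
    with 0 show False
      using vec_eq_0_if_subvecs_eq_0[OF u(1) S] u(2) by (simp add: defs T_def)
  qed
  moreover have "(SS - ST * B * TS) *\<^sub>v uS = k \<cdot>\<^sub>v uS"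
  proof -
    have TSu: "TS *\<^sub>v uS \<in> carrier_vec (card T)"
      using carr by simp
    have STB: "ST * B \<in> carrier_mat (card S) (card T)"
      using carr B by simp
    have "ST *\<^sub>v uT = (ST * B) *\<^sub>v (- (TS *\<^sub>v uS))"
      unfolding uT using assoc_mult_mat_vec[OF carr(4) B, of "- (TS *\<^sub>v uS)"] TSu by simp
    also have "\<dots> = - ((ST * B) *\<^sub>v (TS *\<^sub>v uS))"
      using mult_mat_vec_uminus[OF STB TSu] .
    also have "(ST * B) *\<^sub>v (TS *\<^sub>v uS) = (ST * B * TS) *\<^sub>v uS"
      using assoc_mult_mat_vec[OF STB carr(5,1)] by simp
    finally have STu: "ST *\<^sub>v uT = - ((ST * B * TS) *\<^sub>v uS)" .
    have prod: "ST * B * TS \<in> carrier_mat (card S) (card S)"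
      using STB carr by simp
    have "(SS - ST * B * TS) *\<^sub>v uS = SS *\<^sub>v uS - (ST * B * TS) *\<^sub>v uS"
      using minus_mult_distrib_mat_vec[OF carr(3) prod carr(1)] .
    also have "\<dots> = k \<cdot>\<^sub>v uS"
      unfolding rowS STu using carr prod by (intro eq_vecI) auto
    finally show ?thesis .
  qed
  ultimately show ?thesis
    using carr unfolding eigenvector_def defs[symmetric] by simp
qed

theorem mainTheorem4:
  fixes M :: "complex poly fract mat" and n :: nat and S :: "nat set"
    and lam0 :: complex and u :: "complex vec"
  assumes "M \<in> carrier_mat n n"
    and "S \<subseteq> {..<n}" and "S \<noteq> {}"
    and "in_sigma lam0 M"
    and "no_pole_mat M lam0"
    and "invertible_mat (eval_mat (submatrix M ({..<n} - S) ({..<n} - S)) lam0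
           - lam0 \<cdot>\<^sub>m 1\<^sub>m (card ({..<n} - S)))"
    and "eigenvector (eval_mat M lam0) u lam0"
  shows "no_pole_mat (isospectral_reduction M S) lam0
    \<and> eigenvector (eval_mat (isospectral_reduction M S) lam0) (subvec u S) lam0"
proof -
  define T where "T = {..<n} - S"
  define M' where "M' = eval_mat M lam0"
  note M = assms(1) and S = assms(2)
  have T: "T \<subseteq> {..<n}" by (auto simp: T_def)
  have val: "mat_has_value M lam0 M'"
    using assms(5) by (simp add: mat_has_value_iff M'_def)
  have M': "M' \<in> carrier_mat n n"
    using mat_has_value_carrier[OF val M] .
  note sub = mat_has_value_submatrix[OF val]
  note carr = submatrix_carrier[OF M S S] submatrix_carrier[OF M S T]
    submatrix_carrier[OF M T S] submatrix_carrier[OF M T T]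
  let ?A = "submatrix M T T - lam \<cdot>\<^sub>m 1\<^sub>m (card T)"
  let ?A' = "submatrix M' T T - lam0 \<cdot>\<^sub>m 1\<^sub>m (card T)"
  have "mat_has_value ?A lam0 ?A'"
    using mat_has_value_diff[OF sub mat_has_value_lam_one carr(4)] by simp
  moreover have "?A \<in> carrier_mat (card T) (card T)"
    by (rule minus_carrier_mat) simp
  moreover have "invertible_mat ?A'"
    using assms(6) sub[of T T] by (simp add: mat_has_value_iff T_def)
  ultimately obtain B B' where B: "mat_inverse ?A = Some B" "B \<in> carrier_mat (card T) (card T)"
      "B' \<in> carrier_mat (card T) (card T)" "mat_has_value B lam0 B'" "B' * ?A' = 1\<^sub>m (card T)"
    by (rule has_value_mat_inverse)
  have red: "isospectral_reduction M S =
      submatrix M S S - submatrix M S T * B * submatrix M T S"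
    using M B(1) by (simp add: isospectral_reduction_def Let_def T_def)
  have STB: "submatrix M S T * B \<in> carrier_mat (card S) (card T)"
    using carr(2) B(2) by simp
  have "mat_has_value (isospectral_reduction M S) lam0
      (submatrix M' S S - submatrix M' S T * B' * submatrix M' T S)"
    unfolding red
    using mat_has_value_diff[OF sub
        mat_has_value_mult[OF mat_has_value_mult[OF sub B(4) carr(2) B(2)] sub STB carr(3)] carr(1)]
      STB carr(3) by simp
  moreover have "eigenvector (submatrix M' S S - submatrix M' S T * B' * submatrix M' T S)
      (subvec u S) lam0"
    using schur_eigenvector[OF M' S B(3)[unfolded T_def] B(5)[unfolded T_def]] assms(7)
    by (simp add: M'_def T_def)
  ultimately show ?thesis
    by (simp add: mat_has_value_iff)
qed

end
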